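(* Let $f:\mathbb{R}^d\to\mathbb{R}$ be a function with Fourier representation $$f(\boldsymbol{x})=\int_{\mathbb{R}^d}e^{\mathrm{i}\boldsymbol{\omega}\cdot\boldsymbol{x}}\hat f(\boldsymbol{\omega})\,\mathrm{d}\boldsymbol{\omega},$$ let $B\subset\mathbb{R}^d$ be a compact domain containing $0$, and let $$C_{f,B}=\int_{\mathbb{R}^d}|\boldsymbol{\omega}|_B\,|\hat f(\boldsymbol{\omega})|\,\mathrm{d}\boldsymbol{\omega},\qquad |\boldsymbol{\omega}|_B=\sup_{\boldsymbol{x}\in B}|\boldsymbol{\omega}\cdot\boldsymbol{x}|,$$ be finite. Let $\mu$ be an arbitrary probability measure on $B$. Then for all integers $L,M\ge 1$ there exists a ReLU network $f_{L,M}$ with width $M+d+1$ and depth $L$ such that $$\int_B|f(\boldsymbol{x})-f_{L,M}(\boldsymbol{x})|^2\,\mathrm{d}\mu(\boldsymbol{x})\le\frac{8C_{f,B}^2}{ML}.$$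
   Context: $\mathrm{ReLU}(t)=\max(t,0)$. A ReLU network on $\mathbb{R}^d$ with depth $L$ and width $w$ is a standard fully connected feedforward network (no skip connections) with $L$ hidden layers of $w$ nodes each: every node of the first hidden layer equals $\mathrm{ReLU}$ of an affine function of the inputs $x_1,\dots,x_d$; every node of hidden layer $l+1$ equals $\mathrm{ReLU}$ of an affine function of the nodes of hidden layer $l$; the output is an affine function of the nodes of the last hidden layer. All weights and biases are real. *)

theory Defs
  imports "HOL-Probability.Probability"
begin

definition relu :: "real \<Rightarrow> real" where
  "relu t = max t 0"

(* relu_node w V W b l x j is node j of hidden layer l + 1 on input x, so l = 0 is the layer
   reading the input. V j are the input weights of node j of the first hidden layer, W l j k is
   the weight from node k of layer l + 1 to node j of layer l + 2, and b l j is the bias of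
   node j of layer l + 1. Only the nodes j < w belong to the network. *)
primrec relu_node ::
  "nat \<Rightarrow> (nat \<Rightarrow> real ^ 'd) \<Rightarrow> (nat \<Rightarrow> nat \<Rightarrow> nat \<Rightarrow> real) \<Rightarrow> (nat \<Rightarrow> nat \<Rightarrow> real)
    \<Rightarrow> nat \<Rightarrow> real ^ 'd \<Rightarrow> nat \<Rightarrow> real" where
  "relu_node w V W b 0 = (\<lambda>x j. relu (V j \<bullet> x + b 0 j))"
| "relu_node w V W b (Suc l) =
     (\<lambda>x j. relu ((\<Sum>k<w. W l j k * relu_node w V W b l x k) + b (Suc l) j))"

definition is_relu_network :: "nat \<Rightarrow> nat \<Rightarrow> (real ^ 'd \<Rightarrow> real) \<Rightarrow> bool" where
  "is_relu_network L w F \<longleftrightarrow>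
     1 \<le> L \<and>
     (\<exists>V W b a c. \<forall>x. F x = (\<Sum>k<w. a k * relu_node w V W b (L - 1) x k) + c)"

(* has_bochner_integral includes integrability of the integrand; at x = 0 it says that
   fhat is Lebesgue integrable. *)
definition fourier_representation ::
  "(real ^ 'd \<Rightarrow> real) \<Rightarrow> (real ^ 'd \<Rightarrow> complex) \<Rightarrow> bool" where
  "fourier_representation f fhat \<longleftrightarrow>
     (\<forall>x. has_bochner_integral lebesgue
            (\<lambda>\<omega>. exp (\<i> * complex_of_real (\<omega> \<bullet> x)) * fhat \<omega>) (complex_of_real (f x)))"

(* A genuine supremum only for nonempty bounded B; the real-valued Sup is unspecified otherwise. *)
definition dual_norm_on :: "(real ^ 'd) set \<Rightarrow> real ^ 'd \<Rightarrow> real" where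
  "dual_norm_on B \<omega> = (SUP x\<in>B. \<bar>\<omega> \<bullet> x\<bar>)"

(* The integral is 0 by convention when it diverges, so finiteness of the constant has to be
   assumed separately as integrability. *)
definition fourier_const :: "(real ^ 'd \<Rightarrow> complex) \<Rightarrow> (real ^ 'd) set \<Rightarrow> real" where
  "fourier_const fhat B = (LINT \<omega>|lebesgue. dual_norm_on B \<omega> * norm (fhat \<omega>))"

end

theory Submission
  imports Defs
begin

text \<open>Put \<open>C = fourier_const fhat B\<close> and \<open>N = M * L\<close>. By the fundamental theorem of calculus along
  \<open>\<omega> \<bullet> x \<in> [- a, a]\<close>, \<open>a = dual_norm_on B \<omega>\<close>, the function \<open>f\<close> minus a constant is on \<open>B\<close> the
  mean, over a probability measure on pairs \<open>(\<omega>, s)\<close>, of \<open>C \<kappa> sgn (\<omega> \<bullet> x - s)\<close> with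
  \<open>\<bar>\<kappa>\<bar> \<le> 1\<close>. Sampling \<open>n\<close> pairs (Maurey's argument, done greedily) gives squared error at most
  \<open>C\<^sup>2 / n\<close>. With \<open>n = N div 2\<close> this is at most \<open>3 C\<^sup>2 / N\<close>, strictly below the
  required \<open>8 C\<^sup>2 / N\<close>, so each step may be replaced by a steep ramp, a difference of two ReLU units.
  The degenerate cases \<open>N = 1\<close> and \<open>C = 0\<close> are covered by the constant \<open>f 0\<close>. A sum of \<open>N\<close> units
  is spread over the \<open>L\<close> layers, \<open>M\<close> units per layer.\<close>

section \<open>Computing a sum of ReLU units layer by layer\<close>

lemma sum_lessThan_add_split:
  fixes g :: "nat \<Rightarrow> 'a::comm_monoid_add"
  shows "(\<Sum>k<m + n. g k) = (\<Sum>k<m. g k) + (\<Sum>k<n. g (m + k))"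
  by (induction n) (simp_all add: add.assoc)

text \<open>Later layers see the input only through coordinates shifted by \<open>r\<close>. The
  excess produced by the shift does not depend on \<open>x\<close>, so a bias can cancel it.\<close>

lemma sum_inner_enum:
  fixes v x :: "real ^ 'd"
  assumes "bij_betw e {..<CARD('d)} (UNIV :: 'd set)"
  shows "(\<Sum>k<CARD('d). v $ e k * (x $ e k + r)) = v \<bullet> x + r * (\<Sum>i\<in>UNIV. v $ i)"
proof -
  have "(\<Sum>k<CARD('d). v $ e k * (x $ e k + r)) = (\<Sum>i\<in>UNIV. v $ i * (x $ i + r))"
    using sum.reindex_bij_betw[OF assms, of "\<lambda>i. v $ i * (x $ i + r)"] by simp
  then show ?thesis
    by (simp add: inner_vec_def algebra_simps sum.distrib sum_distrib_left)
qed

lemma relu_nonneg_eq: "0 \<le> t \<Longrightarrow> relu t = t"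
  by (simp add: relu_def)

text \<open>In each layer the nodes \<open>j < M\<close> carry new units, the next \<open>CARD('d)\<close> nodes transport the
  input shifted into the positive range, and the last node accumulates the units of all earlier
  layers, shifted by \<open>T\<close> so that ReLU acts as the identity on it.\<close>

lemma relu_network_of_units:
  fixes B :: "(real ^ 'd) set" and v :: "nat \<Rightarrow> real ^ 'd"
  assumes "bounded B" "1 \<le> L"
  shows "\<exists>F. is_relu_network L (M + CARD('d) + 1) F \<and>
           (\<forall>x\<in>B. F x = c + (\<Sum>i<M * L. a i * relu (v i \<bullet> x + b i)))"
proof -
  obtain R where R: "\<And>x. x \<in> B \<Longrightarrow> norm x \<le> R"
    using assms(1) by (auto simp: bounded_iff)
  obtain e :: "nat \<Rightarrow> 'd" where e: "bij_betw e {..<CARD('d)} UNIV"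
    using ex_bij_betw_nat_finite[of "UNIV :: 'd set"] by (auto simp: atLeast0LessThan)
  define u where "u i x = relu (v i \<bullet> x + b i)" for i x
  \<comment> \<open>On \<open>B\<close> the absolute values of all terms sum to at most
    \<open>T\<close>, so adding \<open>T\<close> makes every partial sum nonnegative.\<close>
  define T where "T = (\<Sum>i<M * L. \<bar>a i\<bar> * (norm (v i) * R + \<bar>b i\<bar>))"
  have T: "0 \<le> T + (\<Sum>i<M * l. a i * u i x)" if x: "x \<in> B" and l: "l \<le> L" for l x
  proof -
    have "\<bar>u i x\<bar> \<le> norm (v i) * R + \<bar>b i\<bar>" for i
    proof -
      have "\<bar>v i \<bullet> x\<bar> \<le> norm (v i) * norm x"
        by (rule Cauchy_Schwarz_ineq2)
      also have "\<dots> \<le> norm (v i) * R"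
        using R[OF x] by (intro mult_left_mono) auto
      finally show ?thesis
        by (auto simp: u_def relu_def max_def abs_if split: if_splits)
    qed
    then have u: "\<bar>a i * u i x\<bar> \<le> \<bar>a i\<bar> * (norm (v i) * R + \<bar>b i\<bar>)" for i
      by (simp add: abs_mult mult_left_mono)
    have "\<bar>\<Sum>i<M * l. a i * u i x\<bar> \<le> (\<Sum>i<M * l. \<bar>a i * u i x\<bar>)"
      by (rule sum_abs)
    also have "\<dots> \<le> (\<Sum>i<M * L. \<bar>a i * u i x\<bar>)"
      using l by (intro sum_mono2) auto
    also have "\<dots> \<le> T"
      unfolding T_def by (intro sum_mono u)
    finally show ?thesis by linarith
  qed
  let ?d = "CARD('d)"
  define V where "V j = (if j < M then v j else if j < M + ?d then axis (e (j - M)) 1 else 0)" for j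
  \<comment> \<open>Three kinds of rows: a new unit reads the transported coordinates, a transport
    node copies itself, and the accumulator adds the units of the preceding layer to its old
    value.\<close>
  define W where "W l j k =
     (if j < M then (if M \<le> k \<and> k < M + ?d then v (M * Suc l + j) $ e (k - M) else 0)
      else if j < M + ?d then (if k = j then 1 else 0)
      else (if k < M then a (M * l + k) else if k = M + ?d then 1 else 0))" for l j k
  \<comment> \<open>The first layer reads \<open>x\<close> itself, so its units need no correction;
    there the biases \<open>R\<close> and \<open>T\<close> introduce the shifts. Later units
    subtract the effect of the shift by \<open>R\<close>.\<close>
  define bb where "bb l j =
     (if j < M then b (M * l + j) - (if l = 0 then 0 else R * (\<Sum>i\<in>UNIV. v (M * l + j) $ i))
      else if l = 0 then (if j < M + ?d then R else T) else 0)" for l j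
  define node where "node = relu_node (M + ?d + 1) V W bb"
  \<comment> \<open>The accumulator lags one layer behind: it holds the units with index below
    \<open>M * l\<close>, while those of the current layer still sit in the first \<open>M\<close>
    nodes.\<close>
  have inv: "(\<forall>j<M. node l x j = u (M * l + j) x)
       \<and> (\<forall>j<?d. node l x (M + j) = x $ e j + R)
       \<and> node l x (M + ?d) = T + (\<Sum>i<M * l. a i * u i x)" if x: "x \<in> B" and l: "l < L" for l x
    using l
  proof (induction l)
    case 0
    have "- R \<le> x $ i" for i
      using component_le_norm_cart[of x i] R[OF x] by linarith
    moreover have "0 \<le> T"
      using T[OF x, of 0] by simp
    ultimately show ?case
      by (auto simp: node_def V_def bb_def u_def inner_axis inner_commute relu_def max_def)
         (smt (verit))
  next
    case (Suc l)
    then have IH: "\<And>j. j < M \<Longrightarrow> node l x j = u (M * l + j) x"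
       "\<And>j. j < ?d \<Longrightarrow> node l x (M + j) = x $ e j + R"
       "node l x (M + ?d) = T + (\<Sum>i<M * l. a i * u i x)"
      by auto
    have xR: "0 \<le> x $ i + R" for i
      using component_le_norm_cart[of x i] R[OF x] by linarith
    have step: "node (Suc l) x j = relu ((\<Sum>k<M. W l j k * u (M * l + k) x)
         + (\<Sum>k<?d. W l j (M + k) * (x $ e k + R))
         + W l j (M + ?d) * (T + (\<Sum>i<M * l. a i * u i x)) + bb (Suc l) j)" for j
    proof -
      have "node (Suc l) x j = relu ((\<Sum>k<M + ?d + 1. W l j k * node l x k) + bb (Suc l) j)"
        by (simp add: node_def)
      then show ?thesis
        by (simp add: sum_lessThan_add_split IH del: relu_node.simps)
    qed
    have "node (Suc l) x j = u (M * Suc l + j) x" if "j < M" for j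
      using that sum_inner_enum[OF e, of "v (M * Suc l + j)" x R]
      by (simp add: step W_def bb_def u_def)
    moreover have "node (Suc l) x (M + j) = x $ e j + R" if "j < ?d" for j
      using that xR by (simp add: step W_def bb_def relu_nonneg_eq if_distrib[of "\<lambda>c. c * _"] sum.delta cong: if_cong)
    moreover have "node (Suc l) x (M + ?d) = T + (\<Sum>i<M * Suc l. a i * u i x)"
    proof -
      have "(\<Sum>i<M * Suc l. a i * u i x) = (\<Sum>i<M * l. a i * u i x) + (\<Sum>k<M. a (M * l + k) * u (M * l + k) x)"
        using sum_lessThan_add_split[of "\<lambda>i. a i * u i x" "M * l" M] by (simp add: add.commute)
      then show ?thesis
        using T[OF x, of "Suc l"] Suc.prems
        by (simp add: step W_def bb_def relu_nonneg_eq algebra_simps)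
    qed
    ultimately show ?case by blast
  qed
  \<comment> \<open>The output adds the units of the last layer, which the accumulator has not yet
    received, and removes the shift \<open>T\<close>.\<close>
  define F where "F x = (\<Sum>k<M + ?d + 1. (if k < M then a (M * (L - 1) + k) else if k = M + ?d then 1 else 0)
      * node (L - 1) x k) + (c - T)" for x
  have "is_relu_network L (M + ?d + 1) F"
    unfolding is_relu_network_def F_def node_def
    by (intro conjI assms(2) exI[of _ V] exI[of _ W] exI[of _ bb] exI[of _ "\<lambda>k. if k < M then a (M * (L - 1) + k) else if k = M + ?d then 1 else 0"]
          exI[of _ "c - T"] allI refl)
  moreover have "F x = c + (\<Sum>i<M * L. a i * relu (v i \<bullet> x + b i))" if x: "x \<in> B" for x
  proof -
    have "M * L = M * (L - 1) + M"
      using assms(2) by (cases L) auto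
    then have "(\<Sum>i<M * L. a i * u i x) = (\<Sum>i<M * (L - 1). a i * u i x)
        + (\<Sum>k<M. a (M * (L - 1) + k) * u (M * (L - 1) + k) x)"
      using sum_lessThan_add_split[of "\<lambda>i. a i * u i x" "M * (L - 1)" M] by metis
    then show ?thesis
      using inv[OF x, of "L - 1"] assms(2)
      by (simp add: F_def sum_lessThan_add_split u_def[symmetric])
  qed
  ultimately show ?thesis by blast
qed

section \<open>Maurey's sampling argument, done greedily\<close>

lemma mean_measurable_bounded:
  assumes "prob_space P"
  assumes G[measurable]: "(\<lambda>(p, x). G p x) \<in> borel_measurable (P \<Otimes>\<^sub>M N)"
    and GK: "\<And>p x. \<bar>G p x\<bar> \<le> (K::real)"
    and h: "\<And>x. x \<in> space N \<Longrightarrow> h x = (LINT p|P. G p x)"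
  shows "h \<in> borel_measurable N" and "\<And>x. x \<in> space N \<Longrightarrow> \<bar>h x\<bar> \<le> K"
proof -
  interpret P: prob_space P by fact
  have Gint: "integrable P (\<lambda>p. G p x)" if "x \<in> space N" for x
    using GK measurable_Pair1[OF G that] by (intro P.integrable_const_bound[where B=K]) auto
  have "(\<lambda>x. LINT p|P. G p x) \<in> borel_measurable N"
    by (rule P.borel_measurable_lebesgue_integral) measurable
  then show "h \<in> borel_measurable N"
    by (subst measurable_cong[OF h])
  show "\<bar>h x\<bar> \<le> K" if "x \<in> space N" for x
  proof -
    have "h x \<le> K" "- K \<le> h x"
      unfolding h[OF that] using Gint[OF that] GK
      by (auto intro!: P.integral_le_const P.integral_ge_const AE_I2 simp: abs_le_iff minus_le_iff)
    then show ?thesis by linarith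
  qed
qed

text \<open>Averaged over \<open>p\<close>, the cross term vanishes and the new term contributes the variance of
  \<open>G p x\<close>, so some \<open>p\<close> is at least as good as the average.\<close>

lemma maurey_greedy_step:
  assumes "prob_space P" "prob_space N"
  assumes G[measurable]: "(\<lambda>(p, x). G p x) \<in> borel_measurable (P \<Otimes>\<^sub>M N)"
    and GK: "\<And>p x. \<bar>G p x\<bar> \<le> (K::real)"
    and h: "\<And>x. x \<in> space N \<Longrightarrow> h x = (LINT p|P. G p x)"
    and S[measurable]: "S \<in> borel_measurable N" and SK: "\<And>x. x \<in> space N \<Longrightarrow> \<bar>S x\<bar> \<le> (A::real)"
  shows "\<exists>p\<in>space P. (LINT x|N. (S x + (h x - G p x))\<^sup>2) \<le> (LINT x|N. (S x)\<^sup>2) + K\<^sup>2"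
proof -
  interpret P: prob_space P by fact
  interpret N: prob_space N by fact
  interpret PN: pair_prob_space P N ..
  have Gx[measurable]: "G p \<in> borel_measurable N" if "p \<in> space P" for p
    using measurable_Pair2[OF G that] by simp
  have Gp[measurable]: "(\<lambda>p. G p x) \<in> borel_measurable P" if "x \<in> space N" for x
    using measurable_Pair1[OF G that] by simp
  have Gint: "integrable P (\<lambda>p. G p x)" if "x \<in> space N" for x
    using GK that by (intro P.integrable_const_bound[where B=K]) auto
  have hm[measurable]: "h \<in> borel_measurable N" and hK: "\<And>x. x \<in> space N \<Longrightarrow> \<bar>h x\<bar> \<le> K"
    using mean_measurable_bounded[OF assms(1) G GK h] by blast+
  have K0: "0 \<le> K"
    using GK[of undefined undefined] by linarith
  let ?H = "\<lambda>p x. (S x + (h x - G p x))\<^sup>2"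
  have Hm[measurable]: "(\<lambda>(p, x). ?H p x) \<in> borel_measurable (P \<Otimes>\<^sub>M N)"
    by measurable
  have HK: "\<bar>?H p x\<bar> \<le> (A + 2 * K)\<^sup>2" if "x \<in> space N" for p x
  proof -
    have "\<bar>S x + (h x - G p x)\<bar> \<le> A + 2 * K"
      using SK[OF that] hK[OF that] GK[of p x] by linarith
    then show ?thesis by (metis abs_ge_zero abs_power2 power2_abs power_mono)
  qed
  have Hint: "integrable (P \<Otimes>\<^sub>M N) (\<lambda>(p, x). ?H p x)"
    using HK by (intro PN.integrable_const_bound[where B="(A + 2 * K)\<^sup>2"])
      (auto simp: space_pair_measure)
  have S2: "integrable N (\<lambda>x. (S x)\<^sup>2)"
  proof (rule N.integrable_const_bound[where B="A\<^sup>2"])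
    show "AE x in N. norm ((S x)\<^sup>2) \<le> A\<^sup>2"
      using SK by (auto intro!: AE_I2 simp: abs_le_square_iff[symmetric]) (meson abs_ge_self abs_le_square_iff order.trans)
  qed measurable
  have pointwise: "(LINT p|P. ?H p x) \<le> (S x)\<^sup>2 + K\<^sup>2" if x: "x \<in> space N" for x
  proof -
    have G2: "integrable P (\<lambda>p. (G p x)\<^sup>2)"
      using GK x by (intro P.integrable_const_bound[where B="K\<^sup>2"])
        (auto intro!: AE_I2 simp: power2_eq_square abs_mult[symmetric], metis abs_ge_zero abs_mult abs_mult_self_eq mult_mono' GK)
    have "(LINT p|P. ?H p x) = (LINT p|P. (S x + h x)\<^sup>2 - 2 * (S x + h x) * G p x + (G p x)\<^sup>2)"
      by (simp add: power2_eq_square algebra_simps)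
    also have "\<dots> = (S x + h x)\<^sup>2 - 2 * (S x + h x) * h x + (LINT p|P. (G p x)\<^sup>2)"
      using Gint[OF x] G2 by (simp add: h[OF x] P.prob_space)
    also have "(LINT p|P. (G p x)\<^sup>2) \<le> K\<^sup>2"
      using G2 GK K0 by (intro P.integral_le_const AE_I2) (auto simp: abs_le_square_iff[symmetric])
    \<comment> \<open>The term \<open>- (h x)\<^sup>2\<close> is what distinguishes the variance
      from the second moment; the bound simply drops it.\<close>
    also have "(S x + h x)\<^sup>2 - 2 * (S x + h x) * h x + K\<^sup>2 = (S x)\<^sup>2 + K\<^sup>2 - (h x)\<^sup>2"
      by (simp add: power2_eq_square algebra_simps)
    finally show ?thesis by (smt (verit) zero_le_power2)
  qed
  have "(LINT p|P. LINT x|N. ?H p x) = (LINT x|N. LINT p|P. ?H p x)"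
    using PN.Fubini_integral[of ?H] Hint by simp
  also have "\<dots> \<le> (LINT x|N. (S x)\<^sup>2 + K\<^sup>2)"
    using PN.integrable_snd[OF Hint] S2 pointwise by (intro integral_mono) auto
  also have "\<dots> = (LINT x|N. (S x)\<^sup>2) + K\<^sup>2"
    using S2 by (simp add: N.prob_space)
  finally have le: "(LINT p|P. LINT x|N. ?H p x) \<le> (LINT x|N. (S x)\<^sup>2) + K\<^sup>2" .
  show ?thesis
  \<comment> \<open>If every \<open>p\<close> exceeded the bound, so would the mean over
    \<open>P\<close>, strictly because \<open>P\<close> is a probability measure.\<close>
  proof (rule ccontr)
    assume "\<not> ?thesis"
    then have "\<And>p. p \<in> space P \<Longrightarrow> (LINT x|N. (S x)\<^sup>2) + K\<^sup>2 < (LINT x|N. ?H p x)"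
      by force
    then have "(LINT x|N. (S x)\<^sup>2) + K\<^sup>2 < (LINT p|P. LINT x|N. ?H p x)"
      using PN.integrable_fst'[OF Hint] by (intro P.expectation_greater) auto
    with le show False by simp
  qed
qed


text \<open>Each greedy choice adds at most \<open>K\<^sup>2\<close> to the squared error of the
  unnormalised sum. Dividing the sum by \<open>n\<close> later gives the rate
  \<open>K\<^sup>2 / n\<close>.\<close>

lemma maurey:
  assumes "prob_space P" "prob_space N"
  assumes G[measurable]: "(\<lambda>(p, x). G p x) \<in> borel_measurable (P \<Otimes>\<^sub>M N)"
    and GK: "\<And>p x. \<bar>G p x\<bar> \<le> (K::real)"
    and h: "\<And>x. x \<in> space N \<Longrightarrow> h x = (LINT p|P. G p x)"
  shows "\<exists>q. (\<forall>i<n. q i \<in> space P) \<and> (LINT x|N. (\<Sum>i<n. h x - G (q i) x)\<^sup>2) \<le> real n * K\<^sup>2"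
proof (induction n)
  case 0
  show ?case by simp
next
  case (Suc n)
  then obtain q where q: "\<forall>i<n. q i \<in> space P"
    and le: "(LINT x|N. (\<Sum>i<n. h x - G (q i) x)\<^sup>2) \<le> real n * K\<^sup>2"
    by blast
  have hm: "h \<in> borel_measurable N" and hK: "\<And>x. x \<in> space N \<Longrightarrow> \<bar>h x\<bar> \<le> K"
    using mean_measurable_bounded[OF assms(1) G GK h] by blast+
  let ?S = "\<lambda>x. \<Sum>i<n. h x - G (q i) x"
  have "?S \<in> borel_measurable N"
    using hm q measurable_Pair2[OF G] by (intro borel_measurable_sum borel_measurable_diff) auto
  moreover have "\<bar>?S x\<bar> \<le> real n * (2 * K)" if x: "x \<in> space N" for x
  proof -
    have "\<bar>h x - G (q i) x\<bar> \<le> 2 * K" for i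
      using hK[OF x] GK[of "q i" x] by linarith
    then have "(\<Sum>i<n. \<bar>h x - G (q i) x\<bar>) \<le> real n * (2 * K)"
      using sum_bounded_above[of "{..<n}" "\<lambda>i. \<bar>h x - G (q i) x\<bar>" "2 * K"] by simp
    then show ?thesis
      using sum_abs[of "\<lambda>i. h x - G (q i) x" "{..<n}"] by linarith
  qed
  ultimately obtain p where p: "p \<in> space P"
    and ple: "(LINT x|N. (?S x + (h x - G p x))\<^sup>2) \<le> (LINT x|N. (?S x)\<^sup>2) + K\<^sup>2"
    using maurey_greedy_step[OF assms(1,2) G GK h] by blast
  have "\<forall>i<Suc n. (q(n := p)) i \<in> space P"
    using p q by (auto simp: less_Suc_eq)
  moreover have "(LINT x|N. (\<Sum>i<Suc n. h x - G ((q(n := p)) i) x)\<^sup>2) \<le> real (Suc n) * K\<^sup>2"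
    using ple le by (simp add: algebra_simps)
  ultimately show ?case by blast
qed

section \<open>Steps and their ramp approximations\<close>

definition step_sgn :: "real \<Rightarrow> real" where
  "step_sgn t = (if 0 \<le> t then 1 else - 1)"

lemma step_sgn_measurable[measurable]: "step_sgn \<in> borel_measurable borel"
  unfolding step_sgn_def[abs_def] by measurable

text \<open>For \<open>m > 0\<close> the ramp rises linearly from -1 at \<open>- 1 / m\<close> to 1
  at 0. Since the rise lies to the left of 0, ramps converge to \<open>step_sgn\<close> at 0 as
  well, where its value is 1.\<close>

definition ramp :: "real \<Rightarrow> real \<Rightarrow> real" where
  "ramp m t = 2 * (relu (m * t + 1) - relu (m * t)) - 1"

lemma relu_measurable[measurable]: "relu \<in> borel_measurable borel"
  unfolding relu_def[abs_def] by measurable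

lemma ramp_measurable[measurable]: "ramp m \<in> borel_measurable borel"
  unfolding ramp_def[abs_def] by measurable

lemma abs_ramp_le: "\<bar>ramp m t\<bar> \<le> 1"
  by (auto simp: ramp_def relu_def max_def)

lemma ramp_tendsto: "(\<lambda>m. ramp (real m) t) \<longlonglongrightarrow> step_sgn t"
proof (rule tendsto_eventually, cases "0 \<le> t")
  case True
  then have "0 \<le> real m * t" for m
    by simp
  then show "\<forall>\<^sub>F m in sequentially. ramp (real m) t = step_sgn t"
    using True by (simp add: ramp_def relu_def step_sgn_def)
next
  case False
  obtain k where k: "1 < real k * (- t)"
    using False ex_less_of_nat_mult[of "- t" 1] by auto
  have "ramp (real m) t = step_sgn t" if "k \<le> m" for m
  proof -
    have "real k * (- t) \<le> real m * (- t)"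
      using that False by (intro mult_right_mono) auto
    then have "real m * t + 1 \<le> 0"
      using k by simp
    then show ?thesis
      using False by (simp add: ramp_def relu_def step_sgn_def)
  qed
  then show "\<forall>\<^sub>F m in sequentially. ramp (real m) t = step_sgn t"
    unfolding eventually_sequentially by blast
qed

section \<open>The dual norm, and a single wave as an integral of steps\<close>

lemma dual_norm_on_ge:
  assumes "bounded B" "x \<in> B"
  shows "\<bar>w \<bullet> x\<bar> \<le> dual_norm_on B w"
proof -
  obtain R where R: "\<And>x. x \<in> B \<Longrightarrow> norm x \<le> R"
    using assms(1) by (auto simp: bounded_iff)
  have "bdd_above ((\<lambda>x. \<bar>w \<bullet> x\<bar>) ` B)"
    by (rule bdd_aboveI2[of _ _ "norm w * R"])
       (meson Cauchy_Schwarz_ineq2 R mult_left_mono norm_ge_zero order_trans)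
  then show ?thesis
    unfolding dual_norm_on_def using assms(2) by (rule cSUP_upper[rotated])
qed

text \<open>A supremum of functions that are Lipschitz with a common constant \<open>R\<close>, a
  bound for the norm on \<open>B\<close>, is again Lipschitz. Continuity serves to make the dual
  norm measurable.\<close>

lemma continuous_on_dual_norm_on:
  assumes "bounded B" "B \<noteq> {}"
  shows "continuous_on UNIV (dual_norm_on B)"
proof -
  obtain R where R: "\<And>x. x \<in> B \<Longrightarrow> norm x \<le> R" and R0: "0 < R"
    using assms(1) by (auto simp: bounded_pos)
  have le: "dual_norm_on B w \<le> dual_norm_on B w' + R * dist w w'" for w w'
  proof -
    have "\<bar>w \<bullet> x\<bar> \<le> dual_norm_on B w' + R * dist w w'" if x: "x \<in> B" for x
    proof -
      have "\<bar>(w - w') \<bullet> x\<bar> \<le> norm (w - w') * norm x"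
        by (rule Cauchy_Schwarz_ineq2)
      also have "\<dots> \<le> norm (w - w') * R"
        using R[OF x] by (intro mult_left_mono) auto
      finally show ?thesis
        using dual_norm_on_ge[OF assms(1) x, of w']
        by (simp add: inner_diff_left dist_norm mult.commute)
    qed
    then show ?thesis
      unfolding dual_norm_on_def[of B w] by (intro cSUP_least assms(2))
  qed
  have "\<bar>dual_norm_on B w - dual_norm_on B w'\<bar> \<le> R * dist w w'" for w w'
    using le[of w w'] le[of w' w] by (auto simp: dist_commute)
  then have "R-lipschitz_on UNIV (dual_norm_on B)"
    using R0 by (intro lipschitz_onI) (auto simp: dist_real_def)
  then show ?thesis
    by (rule lipschitz_on_continuous_on)
qed

text \<open>The constant \<open>cos a * u\<close> is the mean of the endpoint values of \<open>cos z * u - sin z * v\<close>. Centring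
  there, rather than at \<open>z = 0\<close>, allows steps with values \<open>\<plusminus>1\<close> and so halves the sup norm of the
  features.\<close>

lemma integral_step_sgn:
  fixes a z u v :: real
  assumes "\<bar>z\<bar> \<le> a"
  shows "(LINT s|lborel. (if \<bar>s\<bar> \<le> a then 1 else 0) * (- sin s * u - cos s * v) * step_sgn (z - s))
           = 2 * (cos z * u - sin z * v) - 2 * cos a * u"
proof -
  let ?D = "\<lambda>s. - sin s * u - cos s * v" and ?\<phi> = "\<lambda>s. cos s * u - sin s * v"
  have D: "has_bochner_integral lborel (\<lambda>s. ?D s * indicator {l..r} s) (?\<phi> r - ?\<phi> l)" if "l \<le> r" for l r
    using that by (intro has_bochner_integral_FTC_Icc_real) (auto intro!: derivative_eq_intros)
  have "has_bochner_integral lborel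
      (\<lambda>s. 2 * (?D s * indicator {- a..z} s) - ?D s * indicator {- a..a} s)
      (2 * (?\<phi> z - ?\<phi> (- a)) - (?\<phi> a - ?\<phi> (- a)))"
    using assms by (intro has_bochner_integral_diff has_bochner_integral_mult_right D) auto
  \<comment> \<open>On \<open>[- a, a]\<close> the sign of \<open>z - s\<close> is twice the
    indicator of \<open>s \<le> z\<close> minus 1. The closed endpoint \<open>s = z\<close> matches
    \<open>step_sgn 0 = 1\<close>, so the equality is pointwise.\<close>
  also have "(\<lambda>s. 2 * (?D s * indicator {- a..z} s) - ?D s * indicator {- a..a} s)
      = (\<lambda>s. (if \<bar>s\<bar> \<le> a then 1 else 0) * ?D s * step_sgn (z - s))"
    using assms by (auto simp: fun_eq_iff step_sgn_def indicator_def)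
  finally show ?thesis
    by (simp add: has_bochner_integral_integral_eq algebra_simps)
qed

text \<open>A countable cover by sets of finite \<open>lborel\<close> measure keeps its measures
  under completion. This permits Fubini over the frequencies, where \<open>fhat\<close> is only
  Lebesgue measurable.\<close>

lemma sigma_finite_lebesgue: "sigma_finite_measure (lebesgue :: 'a::euclidean_space measure)"
proof -
  obtain A :: "'a set set" where A: "countable A" "A \<subseteq> sets lborel" "\<Union>A = space lborel"
      "\<forall>a\<in>A. emeasure lborel a \<noteq> \<infinity>"
    using sigma_finite_lborel[unfolded sigma_finite_measure_def] by (elim exE conjE) rule
  show ?thesis
  proof (rule sigma_finite_measure.intro, intro exI[of _ A] conjI ballI)
    show "A \<subseteq> sets lebesgue"
      using A(2) sets_completionI_sub by blast
    show "emeasure lebesgue a \<noteq> \<infinity>" if "a \<in> A" for a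
    proof -
      have "emeasure lebesgue a = emeasure lborel a"
        using A(2) that by (subst emeasure_completion) (auto intro: sets_completionI_sub)
      then show ?thesis
        using A(4) that by simp
    qed
  qed (use A in simp_all)
qed

section \<open>Replacing steps by ReLU units\<close>

lemma sum_double:
  fixes g :: "nat \<Rightarrow> real"
  shows "(\<Sum>i<2 * n. g i) = (\<Sum>k<n. g (2 * k) + g (2 * k + 1))"
  by (induction n) (simp_all add: add.assoc)

text \<open>Ramp \<open>k\<close> occupies the units \<open>2 * k\<close> and
  \<open>2 * k + 1\<close>, its constant -1 goes into the offset, and the units from
  \<open>2 * n\<close> on get coefficient 0.\<close>

lemma ramp_sum_as_units:
  fixes w :: "nat \<Rightarrow> real ^ 'd"
  assumes "2 * n \<le> N"
  shows "\<exists>v b a c. \<forall>x. (\<Sum>k<n. \<alpha> k * ramp m (w k \<bullet> x - s k)) = c + (\<Sum>i<N. a i * relu (v i \<bullet> x + b i))"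
proof (intro exI allI)
  fix x :: "real ^ 'd"
  let ?v = "\<lambda>i. m *\<^sub>R w (i div 2)"
    and ?b = "\<lambda>i. (if even i then 1 else 0) - m * s (i div 2)"
    and ?a = "\<lambda>i. if i < 2 * n then (if even i then 2 else - 2) * \<alpha> (i div 2) else 0"
  have "(\<Sum>i<N. ?a i * relu (?v i \<bullet> x + ?b i)) = (\<Sum>i<2 * n. ?a i * relu (?v i \<bullet> x + ?b i))"
    using assms by (intro sum.mono_neutral_right) auto
  also have "\<dots> = (\<Sum>k<n. 2 * \<alpha> k * (relu (m * (w k \<bullet> x - s k) + 1) - relu (m * (w k \<bullet> x - s k))))"
    unfolding sum_double by (intro sum.cong refl) (simp add: algebra_simps)
  also have "\<dots> = (\<Sum>k<n. \<alpha> k * ramp m (w k \<bullet> x - s k)) + (\<Sum>k<n. \<alpha> k)"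
    by (simp add: ramp_def algebra_simps sum.distrib[symmetric] sum_subtractf[symmetric])
  finally show "(\<Sum>k<n. \<alpha> k * ramp m (w k \<bullet> x - s k)) = - (\<Sum>k<n. \<alpha> k)
      + (\<Sum>i<N. ?a i * relu (?v i \<bullet> x + ?b i))"
    by simp
qed

text \<open>As the slope grows, dominated convergence carries the squared error of the ramps to that
  of the steps. A strict bound for the limit is therefore attained at some finite slope.\<close>

lemma ramp_approx:
  fixes f :: "real ^ 'd \<Rightarrow> real" and w :: "nat \<Rightarrow> real ^ 'd"
  assumes "prob_space \<mu>" and f[measurable]: "f \<in> borel_measurable \<mu>"
    and id[measurable]: "(\<lambda>x. x) \<in> borel_measurable \<mu>"
    and fK: "\<forall>x\<in>space \<mu>. \<bar>f x\<bar> \<le> K"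
    and less: "(LINT x|\<mu>. (f x - (\<Sum>k<n. \<alpha> k * step_sgn (w k \<bullet> x - s k)))\<^sup>2) < \<epsilon>"
  shows "\<exists>m. integrable \<mu> (\<lambda>x. (f x - (\<Sum>k<n. \<alpha> k * ramp m (w k \<bullet> x - s k)))\<^sup>2) \<and>
             (LINT x|\<mu>. (f x - (\<Sum>k<n. \<alpha> k * ramp m (w k \<bullet> x - s k)))\<^sup>2) < \<epsilon>"
proof -
  interpret prob_space \<mu> by fact
  let ?A = "(K + (\<Sum>k<n. \<bar>\<alpha> k\<bar>))\<^sup>2"
  let ?F = "\<lambda>m x. (f x - (\<Sum>k<n. \<alpha> k * ramp m (w k \<bullet> x - s k)))\<^sup>2"
  have bnd: "norm (?F m x) \<le> ?A" if x: "x \<in> space \<mu>" for m x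
  proof -
    have "\<bar>\<Sum>k<n. \<alpha> k * ramp m (w k \<bullet> x - s k)\<bar> \<le> (\<Sum>k<n. \<bar>\<alpha> k * ramp m (w k \<bullet> x - s k)\<bar>)"
      by (rule sum_abs)
    also have "\<dots> \<le> (\<Sum>k<n. \<bar>\<alpha> k\<bar>)"
      by (intro sum_mono) (simp add: abs_mult mult_left_le abs_ramp_le)
    finally have "\<bar>f x - (\<Sum>k<n. \<alpha> k * ramp m (w k \<bullet> x - s k))\<bar> \<le> K + (\<Sum>k<n. \<bar>\<alpha> k\<bar>)"
      using bspec[OF fK x] by linarith
    then show ?thesis
      using power_mono[of "\<bar>f x - (\<Sum>k<n. \<alpha> k * ramp m (w k \<bullet> x - s k))\<bar>" _ 2] by simp
  qed
  have "(\<lambda>m. LINT x|\<mu>. ?F (real m) x)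
      \<longlonglongrightarrow> (LINT x|\<mu>. (f x - (\<Sum>k<n. \<alpha> k * step_sgn (w k \<bullet> x - s k)))\<^sup>2)"
  proof (rule integral_dominated_convergence[where w="\<lambda>_. ?A"])
    show "AE x in \<mu>. (\<lambda>m. ?F (real m) x)
        \<longlonglongrightarrow> (f x - (\<Sum>k<n. \<alpha> k * step_sgn (w k \<bullet> x - s k)))\<^sup>2"
      by (intro AE_I2 tendsto_intros ramp_tendsto)
    show "AE x in \<mu>. norm (?F (real m) x) \<le> ?A" for m
      by (intro AE_I2 bnd)
  qed auto
  then have "\<forall>\<^sub>F m in sequentially. (LINT x|\<mu>. ?F (real m) x) < \<epsilon>"
    using less by (rule order_tendstoD)
  then obtain m :: nat where "(LINT x|\<mu>. ?F (real m) x) < \<epsilon>"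
    by (auto simp: eventually_sequentially)
  moreover have "integrable \<mu> (?F (real m))"
    using bnd by (intro integrable_const_bound[where B="?A"]) auto
  ultimately show ?thesis by blast
qed

section \<open>Random step features from the Fourier representation\<close>

lemma abs_rotation_le:
  fixes z :: complex
  shows "\<bar>- sin s * Re z - cos s * Im z\<bar> \<le> norm z"
proof -
  \<comment> \<open>The expression is the derivative in \<open>s\<close> of the real part of
    \<open>cis s * z\<close>, and multiplication by \<open>\<i> * cis s\<close> preserves the
    norm.\<close>
  have "\<bar>- sin s * Re z - cos s * Im z\<bar> = \<bar>Re (\<i> * cis s * z)\<bar>"
    by (simp add: cis.sel)
  also have "\<dots> \<le> norm (\<i> * cis s * z)"
    by (rule abs_Re_le_cmod)
  finally show ?thesis by (simp add: norm_mult)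
qed

context
  fixes f :: "real ^ 'd \<Rightarrow> real"
    and fhat :: "real ^ 'd \<Rightarrow> complex"
    and B :: "(real ^ 'd) set"
    and \<mu> :: "(real ^ 'd) measure"
  assumes fourier: "fourier_representation f fhat"
    and B: "bounded B" "0 \<in> B"
    and fin: "integrable lebesgue (\<lambda>\<omega>. dual_norm_on B \<omega> * norm (fhat \<omega>))"
begin

lemma fhat_measurable[measurable]: "fhat \<in> borel_measurable lebesgue"
proof -
  have "integrable lebesgue (\<lambda>\<omega>. exp (\<i> * complex_of_real (\<omega> \<bullet> 0)) * fhat \<omega>)"
    using fourier unfolding fourier_representation_def by (blast intro: has_bochner_integral_integrable integrable.intros)
  then show ?thesis by (simp add: borel_measurable_integrable)
qed

lemma id_measurable_lebesgue[measurable]: "(\<lambda>\<omega> :: real ^ 'd. \<omega>) \<in> borel_measurable lebesgue"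
  by (simp add: measurable_completion)

lemma dual_norm_on_measurable[measurable]: "dual_norm_on B \<in> borel_measurable lebesgue"
  using continuous_on_dual_norm_on[of B] B
  by (intro measurable_completion) (auto intro: borel_measurable_continuous_onI simp: measurable_lborel1)

lemma dual_norm_on_nonneg: "0 \<le> dual_norm_on B \<omega>"
  using dual_norm_on_ge[OF B, of \<omega>] by simp

lemma fourier_integral:
  "has_bochner_integral lebesgue (\<lambda>\<omega>. cos (\<omega> \<bullet> x) * Re (fhat \<omega>) - sin (\<omega> \<bullet> x) * Im (fhat \<omega>)) (f x)"
proof -
  have "has_bochner_integral lebesgue
      (\<lambda>\<omega>. Re (exp (\<i> * complex_of_real (\<omega> \<bullet> x)) * fhat \<omega>)) (Re (complex_of_real (f x)))"
    using fourier unfolding fourier_representation_def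
    by (intro has_bochner_integral_Re) blast
  then show ?thesis
    by (simp add: Re_exp Im_exp)
qed

lemma fourier_const_nonneg: "0 \<le> fourier_const fhat B"
  unfolding fourier_const_def by (intro integral_nonneg_AE AE_I2 mult_nonneg_nonneg dual_norm_on_nonneg) auto

text \<open>Follows from \<open>norm (cis t - 1) \<le> \<bar>t\<bar>\<close> under the integral. It
  settles the degenerate cases and bounds \<open>f\<close> on \<open>B\<close> for dominated
  convergence.\<close>

lemma abs_diff_0_le:
  assumes "x \<in> B"
  shows "\<bar>f x - f 0\<bar> \<le> fourier_const fhat B"
proof -
  let ?g = "\<lambda>\<omega>. (cos (\<omega> \<bullet> x) * Re (fhat \<omega>) - sin (\<omega> \<bullet> x) * Im (fhat \<omega>))
       - (cos (\<omega> \<bullet> 0) * Re (fhat \<omega>) - sin (\<omega> \<bullet> 0) * Im (fhat \<omega>))"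
  have g: "has_bochner_integral lebesgue ?g (f x - f 0)"
    by (intro has_bochner_integral_diff fourier_integral)
  have "norm (?g \<omega>) \<le> dual_norm_on B \<omega> * norm (fhat \<omega>)" for \<omega>
  proof -
    have eq: "?g \<omega> = Re ((cis (\<omega> \<bullet> x) - 1) * fhat \<omega>)"
      by (simp add: cis.sel algebra_simps)
    have "norm (?g \<omega>) \<le> norm ((cis (\<omega> \<bullet> x) - 1) * fhat \<omega>)"
      unfolding eq real_norm_def by (rule abs_Re_le_cmod)
    also have "\<dots> \<le> \<bar>\<omega> \<bullet> x\<bar> * norm (fhat \<omega>)"
      using iexp_approx1[of "\<omega> \<bullet> x" 0] by (simp add: norm_mult cis_conv_exp mult_right_mono)
    also have "\<dots> \<le> dual_norm_on B \<omega> * norm (fhat \<omega>)"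
      using dual_norm_on_ge[OF B(1) assms] by (intro mult_right_mono) auto
    finally show ?thesis .
  qed
  then have "norm (LINT \<omega>|lebesgue. ?g \<omega>) \<le> fourier_const fhat B"
    unfolding fourier_const_def
    using fin g by (intro Bochner_Integration.integral_norm_bound_integral) (auto simp: has_bochner_integral_iff)
  then show ?thesis
    using g by (simp add: has_bochner_integral_integral_eq)
qed

text \<open>Measurability of \<open>f\<close> comes from its representation as an integral depending
  on the parameter \<open>x\<close>.\<close>

lemma f_measurable:
  assumes id[measurable]: "(\<lambda>x. x) \<in> borel_measurable \<mu>"
  shows "f \<in> borel_measurable \<mu>"
proof -
  interpret sigma_finite_measure "lebesgue :: (real ^ 'd) measure"
    by (rule sigma_finite_lebesgue)
  have "(\<lambda>x. LINT \<omega>|lebesgue. cos (\<omega> \<bullet> x) * Re (fhat \<omega>) - sin (\<omega> \<bullet> x) * Im (fhat \<omega>))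
      \<in> borel_measurable \<mu>"
    by (rule borel_measurable_lebesgue_integral) measurable
  then show ?thesis
    unfolding has_bochner_integral_integral_eq[OF fourier_integral] .
qed

text \<open>Over a fixed frequency the admissible \<open>s\<close> form an interval of length
  \<open>2 * dual_norm_on B \<omega>\<close>; hence the factor 2 in the normalisation to total mass
  1.\<close>

definition param_density :: "(real ^ 'd) \<times> real \<Rightarrow> real" where
  "param_density = (\<lambda>(\<omega>, s). (if \<bar>s\<bar> \<le> dual_norm_on B \<omega> then 1 else 0) * (norm (fhat \<omega>) / (2 * fourier_const fhat B)))"

definition param_measure :: "((real ^ 'd) \<times> real) measure" where
  "param_measure = density (lebesgue \<Otimes>\<^sub>M lborel) (\<lambda>p. ennreal (param_density p))"

text \<open>If \<open>fhat \<omega> = 0\<close> the quotient below is \<open>0\<close> by convention.\<close>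

definition feature :: "(real ^ 'd) \<times> real \<Rightarrow> real ^ 'd \<Rightarrow> real" where
  "feature = (\<lambda>(\<omega>, s) x. fourier_const fhat B * ((- sin s * Re (fhat \<omega>) - cos s * Im (fhat \<omega>)) / norm (fhat \<omega>))
      * step_sgn (\<omega> \<bullet> x - s))"

lemma abs_feature_le: "\<bar>feature p x\<bar> \<le> fourier_const fhat B"
proof -
  obtain \<omega> s where p: "p = (\<omega>, s)" by fastforce
  let ?\<kappa> = "(- sin s * Re (fhat \<omega>) - cos s * Im (fhat \<omega>)) / norm (fhat \<omega>)"
  have "\<bar>?\<kappa>\<bar> \<le> 1"
    using abs_rotation_le[of s "fhat \<omega>"] by (simp add: divide_le_eq_1)
  moreover have "\<bar>feature p x\<bar> = fourier_const fhat B * \<bar>?\<kappa>\<bar>"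
    using fourier_const_nonneg by (simp add: feature_def p abs_mult step_sgn_def)
  ultimately show ?thesis
    using fourier_const_nonneg by (simp only: mult_left_le)
qed

lemma param_density_measurable[measurable]: "param_density \<in> borel_measurable (lebesgue \<Otimes>\<^sub>M lborel)"
  unfolding param_density_def by measurable

lemma sets_param_measure[measurable_cong]: "sets param_measure = sets (lebesgue \<Otimes>\<^sub>M lborel)"
  by (simp add: param_measure_def)

lemma feature_measurable:
  assumes id[measurable]: "(\<lambda>x. x) \<in> borel_measurable \<mu>"
  shows "(\<lambda>(p, x). feature p x) \<in> borel_measurable (param_measure \<Otimes>\<^sub>M \<mu>)"
  unfolding feature_def case_prod_beta by measurable

lemma param_density_nonneg: "0 \<le> param_density p"
  using fourier_const_nonneg by (auto simp: param_density_def split: prod.split)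

lemma prob_space_param:
  assumes C: "0 < fourier_const fhat B"
  shows "prob_space param_measure"
proof
  let ?C = "fourier_const fhat B"
  have "emeasure param_measure (space param_measure) = (\<integral>\<^sup>+ p. ennreal (param_density p) \<partial>(lebesgue \<Otimes>\<^sub>M lborel))"
    unfolding param_measure_def space_density
    by (subst emeasure_density[OF _ sets.top]) (auto intro!: nn_integral_cong)
  also have "\<dots> = (\<integral>\<^sup>+ \<omega>. \<integral>\<^sup>+ s. ennreal (param_density (\<omega>, s)) \<partial>lborel \<partial>lebesgue)"
    by (rule lborel.nn_integral_fst[symmetric]) measurable
  also have "\<dots> = (\<integral>\<^sup>+ \<omega>. ennreal (dual_norm_on B \<omega> * norm (fhat \<omega>) / ?C) \<partial>lebesgue)"
  proof (intro nn_integral_cong)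
    fix \<omega> :: "real ^ 'd"
    have "(\<integral>\<^sup>+ s. ennreal (param_density (\<omega>, s)) \<partial>lborel)
        = (\<integral>\<^sup>+ s. ennreal (norm (fhat \<omega>) / (2 * ?C)) * indicator {- dual_norm_on B \<omega>..dual_norm_on B \<omega>} s \<partial>lborel)"
      by (intro nn_integral_cong) (auto simp: param_density_def indicator_def)
    also have "\<dots> = ennreal (norm (fhat \<omega>) / (2 * ?C)) * ennreal (2 * dual_norm_on B \<omega>)"
      using dual_norm_on_nonneg[of \<omega>] by (simp add: nn_integral_cmult_indicator)
    also have "\<dots> = ennreal (dual_norm_on B \<omega> * norm (fhat \<omega>) / ?C)"
      using C dual_norm_on_nonneg[of \<omega>] by (simp add: ennreal_mult'[symmetric] field_simps)
    finally show "(\<integral>\<^sup>+ s. ennreal (param_density (\<omega>, s)) \<partial>lborel) = ennreal (dual_norm_on B \<omega> * norm (fhat \<omega>) / ?C)" .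
  qed
  also have "\<dots> = ennreal (LINT \<omega>|lebesgue. dual_norm_on B \<omega> * norm (fhat \<omega>) / ?C)"
    using fin C dual_norm_on_nonneg by (intro nn_integral_eq_integral) auto
  also have "\<dots> = 1"
    using C by (simp add: fourier_const_def)
  finally show "emeasure param_measure (space param_measure) = 1" .
qed

text \<open>By Fubini, integrating over \<open>s\<close> first turns each frequency into its wave
  minus the constant from \<open>integral_step_sgn\<close>. Integrating over the frequencies then
  gives \<open>f x\<close> minus a constant independent of \<open>x\<close>.\<close>

lemma integral_feature:
  assumes C: "0 < fourier_const fhat B" and x: "x \<in> B"
  shows "f x - (LINT \<omega>|lebesgue. cos (dual_norm_on B \<omega>) * Re (fhat \<omega>)) = (LINT p|param_measure. feature p x)"
proof -
  let ?C = "fourier_const fhat B" and ?a = "dual_norm_on B"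
  interpret P: prob_space param_measure
    by (rule prob_space_param[OF C])
  interpret L: sigma_finite_measure "lebesgue :: (real ^ 'd) measure"
    by (rule sigma_finite_lebesgue)
  interpret LL: pair_sigma_finite "lebesgue :: (real ^ 'd) measure" lborel ..
  have m[measurable]: "(\<lambda>p. feature p x) \<in> borel_measurable (lebesgue \<Otimes>\<^sub>M lborel)"
    unfolding feature_def case_prod_beta by measurable
  have "integrable param_measure (\<lambda>p. feature p x)"
    using abs_feature_le by (intro P.integrable_const_bound[where B="?C"]) auto
  then have int: "integrable (lebesgue \<Otimes>\<^sub>M lborel) (\<lambda>p. param_density p * feature p x)"
    unfolding param_measure_def
    by (subst (asm) integrable_density) (auto simp: param_density_nonneg)
  have "(LINT p|param_measure. feature p x) = (LINT p|(lebesgue \<Otimes>\<^sub>M lborel). param_density p * feature p x)"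
    unfolding param_measure_def by (subst integral_density) (auto simp: param_density_nonneg)
  also have "\<dots> = (LINT \<omega>|lebesgue. LINT s|lborel. param_density (\<omega>, s) * feature (\<omega>, s) x)"
    using LL.integral_fst'[OF int] by simp
  also have "\<dots> = (LINT \<omega>|lebesgue. (cos (\<omega> \<bullet> x) * Re (fhat \<omega>) - sin (\<omega> \<bullet> x) * Im (fhat \<omega>))
      - cos (?a \<omega>) * Re (fhat \<omega>))"
  proof (rule Bochner_Integration.integral_cong[OF refl])
    fix \<omega> :: "real ^ 'd"
    \<comment> \<open>The constant and \<open>norm (fhat \<omega>)\<close> cancel between density
      and feature. Where \<open>fhat \<omega> = 0\<close>, both sides vanish.\<close>
    have "param_density (\<omega>, s) * feature (\<omega>, s) x
       = 1 / 2 * ((if \<bar>s\<bar> \<le> ?a \<omega> then 1 else 0) * (- sin s * Re (fhat \<omega>) - cos s * Im (fhat \<omega>)) * step_sgn (\<omega> \<bullet> x - s))"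
      for s
      using C by (cases "fhat \<omega> = 0") (auto simp: param_density_def feature_def)
    then show "(LINT s|lborel. param_density (\<omega>, s) * feature (\<omega>, s) x)
       = (cos (\<omega> \<bullet> x) * Re (fhat \<omega>) - sin (\<omega> \<bullet> x) * Im (fhat \<omega>)) - cos (?a \<omega>) * Re (fhat \<omega>)"
      by (simp only: integral_mult_right_zero integral_step_sgn[OF dual_norm_on_ge[OF B(1) x]]) simp
  qed
  also have "\<dots> = f x - (LINT \<omega>|lebesgue. cos (?a \<omega>) * Re (fhat \<omega>))"
  proof -
    have "integrable lebesgue (\<lambda>\<omega>. Re (fhat \<omega>))"
      using fourier_integral[of 0] by (simp add: has_bochner_integral_iff)
    then have "integrable lebesgue (\<lambda>\<omega>. cos (?a \<omega>) * Re (fhat \<omega>))"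
      by (rule Bochner_Integration.integrable_bound) (auto simp: abs_mult mult_left_le_one_le intro!: AE_I2)
    then show ?thesis
      using fourier_integral[of x] by (simp add: has_bochner_integral_iff)
  qed
  finally show ?thesis by simp
qed

lemma step_approximation:
  assumes C: "0 < fourier_const fhat B" and \<mu>: "prob_space \<mu>" "space \<mu> = B"
    and id: "(\<lambda>x. x) \<in> borel_measurable \<mu>" and n: "0 < n"
  shows "\<exists>c \<alpha> w s. (LINT x|\<mu>. (f x - c - (\<Sum>k<n. \<alpha> k * step_sgn (w k \<bullet> x - s k)))\<^sup>2)
           \<le> (fourier_const fhat B)\<^sup>2 / real n"
proof -
  let ?C = "fourier_const fhat B"
  define c where "c = (LINT \<omega>|lebesgue. cos (dual_norm_on B \<omega>) * Re (fhat \<omega>))"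
  obtain q where q: "(LINT x|\<mu>. (\<Sum>i<n. (f x - c) - feature (q i) x)\<^sup>2) \<le> real n * ?C\<^sup>2"
    using maurey[OF prob_space_param[OF C] \<mu>(1) feature_measurable[OF id] abs_feature_le, of "\<lambda>x. f x - c"]
      integral_feature[OF C] \<mu>(2) unfolding c_def by blast
  define w where "w i = fst (q i)" for i
  define s where "s i = snd (q i)" for i
  \<comment> \<open>The coefficient of the sampled feature, divided by \<open>n\<close> so that the
    sum becomes an average.\<close>
  define \<alpha> where "\<alpha> i = ?C * ((- sin (s i) * Re (fhat (w i)) - cos (s i) * Im (fhat (w i))) / norm (fhat (w i))) / n" for i
  have "f x - c - (\<Sum>k<n. \<alpha> k * step_sgn (w k \<bullet> x - s k)) = (\<Sum>i<n. (f x - c) - feature (q i) x) / real n" for x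
  proof -
    have "feature (q i) x = n * (\<alpha> i * step_sgn (w i \<bullet> x - s i))" for i
      using n by (simp add: feature_def w_def s_def \<alpha>_def case_prod_beta)
    then show ?thesis
      using n by (simp add: sum_subtractf sum.distrib sum_distrib_left[symmetric] field_simps)
  qed
  then have "(LINT x|\<mu>. (f x - c - (\<Sum>k<n. \<alpha> k * step_sgn (w k \<bullet> x - s k)))\<^sup>2)
      = (LINT x|\<mu>. (\<Sum>i<n. (f x - c) - feature (q i) x)\<^sup>2) / (real n)\<^sup>2"
    by (simp add: power_divide)
  also have "\<dots> \<le> real n * ?C\<^sup>2 / (real n)\<^sup>2"
    using q by (intro divide_right_mono) auto
  also have "\<dots> = ?C\<^sup>2 / real n"
    using n by (simp add: power2_eq_square)
  finally show ?thesis by blast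
qed

section \<open>The error bound for a sum of N units\<close>

lemma relu_units_approximation:
  assumes \<mu>: "prob_space \<mu>" "space \<mu> = B" and id: "(\<lambda>x. x) \<in> borel_measurable \<mu>" and N: "0 < N"
  shows "\<exists>v b a c. integrable \<mu> (\<lambda>x. (f x - (c + (\<Sum>i<N. a i * relu (v i \<bullet> x + b i))))\<^sup>2) \<and>
    (LINT x|\<mu>. (f x - (c + (\<Sum>i<N. a i * relu (v i \<bullet> x + b i))))\<^sup>2)
      \<le> 8 * (fourier_const fhat B)\<^sup>2 / real N"
proof -
  let ?C = "fourier_const fhat B"
  interpret prob_space \<mu> by fact
  note fm[measurable] = f_measurable[OF id]
  \<comment> \<open>A single unit cannot form a ramp, and for \<open>?C = 0\<close> there is neither
    a parameter measure nor strict slack.\<close>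
  consider "N = 1 \<or> ?C = 0" | "2 \<le> N" "0 < ?C"
    using N fourier_const_nonneg by linarith
  then show ?thesis
  proof cases
    case 1
    have bnd: "(f x - f 0)\<^sup>2 \<le> ?C\<^sup>2" if "x \<in> space \<mu>" for x
      using abs_diff_0_le[of x] that \<mu>(2) fourier_const_nonneg by (simp add: abs_le_square_iff[symmetric])
    then have int: "integrable \<mu> (\<lambda>x. (f x - f 0)\<^sup>2)"
      by (intro integrable_const_bound[where B="?C\<^sup>2"]) auto
    moreover have "(LINT x|\<mu>. (f x - f 0)\<^sup>2) \<le> ?C\<^sup>2"
      using int bnd by (intro integral_le_const AE_I2)
    moreover have "?C\<^sup>2 \<le> 8 * ?C\<^sup>2 / real N"
      using 1 by auto
    ultimately show ?thesis
      by (intro exI[of _ "\<lambda>_. 0"] exI[of _ "f 0"]) simp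
  next
    case 2
    define n where "n = N div 2"
    \<comment> \<open>The worst case of the last bound is \<open>N = 3\<close>, where
      \<open>n = 1\<close> and one unit stays idle.\<close>
    have n: "0 < n" "2 * n \<le> N" "N \<le> 3 * n"
      using 2(1) by (auto simp: n_def)
    obtain c \<alpha> w s where le: "(LINT x|\<mu>. (f x - c - (\<Sum>k<n. \<alpha> k * step_sgn (w k \<bullet> x - s k)))\<^sup>2) \<le> ?C\<^sup>2 / real n"
      using step_approximation[OF 2(2) \<mu> id n(1)] by blast
    have "real N \<le> 3 * real n"
      using n(3) by linarith
    \<comment> \<open>Here 3 < 8 and \<open>0 < ?C\<close> give the strict slack that the passage
      from steps to ramps consumes.\<close>
    then have "real N * ?C\<^sup>2 < 8 * real n * ?C\<^sup>2"
      using n(1) 2(2) by (intro mult_strict_right_mono) auto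
    then have "?C\<^sup>2 / real n < 8 * ?C\<^sup>2 / real N"
      using n(1) N by (simp add: field_simps)
    with le have less: "(LINT x|\<mu>. (f x - c - (\<Sum>k<n. \<alpha> k * step_sgn (w k \<bullet> x - s k)))\<^sup>2) < 8 * ?C\<^sup>2 / real N"
      by linarith
    have fm': "(\<lambda>x. f x - c) \<in> borel_measurable \<mu>"
      by measurable
    have bnd: "\<forall>x\<in>space \<mu>. \<bar>f x - c\<bar> \<le> ?C + \<bar>f 0 - c\<bar>"
      unfolding \<mu>(2) using abs_diff_0_le by (smt (verit))
    obtain m where m: "integrable \<mu> (\<lambda>x. (f x - c - (\<Sum>k<n. \<alpha> k * ramp m (w k \<bullet> x - s k)))\<^sup>2)"
        "(LINT x|\<mu>. (f x - c - (\<Sum>k<n. \<alpha> k * ramp m (w k \<bullet> x - s k)))\<^sup>2) < 8 * ?C\<^sup>2 / real N"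
      using ramp_approx[OF \<mu>(1) fm' id bnd less] by (elim exE conjE) rule
    obtain v b a c' where units: "\<forall>x. (\<Sum>k<n. \<alpha> k * ramp m (w k \<bullet> x - s k)) = c' + (\<Sum>i<N. a i * relu (v i \<bullet> x + b i))"
      using ramp_sum_as_units[OF n(2), of \<alpha> m w s] by (elim exE) rule
    have eq: "f x - c - (\<Sum>k<n. \<alpha> k * ramp m (w k \<bullet> x - s k)) = f x - (c + c' + (\<Sum>i<N. a i * relu (v i \<bullet> x + b i)))" for x
      using spec[OF units, of x] by simp
    from m show ?thesis
      unfolding eq by (intro exI conjI less_imp_le)
  qed
qed

end

theorem theorem12:
  fixes f :: "real ^ 'd \<Rightarrow> real"
    and fhat :: "real ^ 'd \<Rightarrow> complex"
    and B :: "(real ^ 'd) set"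
    and \<mu> :: "(real ^ 'd) measure"
    and L M :: nat
  assumes "fourier_representation f fhat"
    and "compact B" and "0 \<in> B"
    and "integrable lebesgue (\<lambda>\<omega>. dual_norm_on B \<omega> * norm (fhat \<omega>))"
    and "prob_space \<mu>" and "sets \<mu> = sets (restrict_space borel B)"
    and "1 \<le> L" and "1 \<le> M"
  shows "\<exists>F. is_relu_network L (M + CARD('d) + 1) F \<and>
           integrable \<mu> (\<lambda>x. \<bar>f x - F x\<bar> ^ 2) \<and>
           (LINT x|\<mu>. \<bar>f x - F x\<bar> ^ 2) \<le> 8 * (fourier_const fhat B)\<^sup>2 / (real M * real L)"
proof -
  have B: "bounded B"
    using assms(2) by (rule compact_imp_bounded)
  have space: "space \<mu> = B"
    using sets_eq_imp_space_eq[OF assms(6)] by (simp add: space_restrict_space)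
  have id: "(\<lambda>x. x) \<in> borel_measurable \<mu>"
    unfolding measurable_cong_sets[OF assms(6) refl] by (intro measurable_restrict_space1) simp
  have "0 < M * L"
    using assms(7,8) by simp
  from relu_units_approximation[OF assms(1) B assms(3,4,5) space id this]
  obtain v b a c where
    int: "integrable \<mu> (\<lambda>x. (f x - (c + (\<Sum>i<M * L. a i * relu (v i \<bullet> x + b i))))\<^sup>2)"
    and le: "(LINT x|\<mu>. (f x - (c + (\<Sum>i<M * L. a i * relu (v i \<bullet> x + b i))))\<^sup>2)
      \<le> 8 * (fourier_const fhat B)\<^sup>2 / real (M * L)"
    by blast
  obtain F where F: "is_relu_network L (M + CARD('d) + 1) F"
    "\<And>x. x \<in> B \<Longrightarrow> F x = c + (\<Sum>i<M * L. a i * relu (v i \<bullet> x + b i))"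
    using relu_network_of_units[OF B assms(7), of M c a v b] by blast
  \<comment> \<open>The network equals the sum of units only on \<open>B\<close>, which is the whole
    space of \<mu>.\<close>
  have eq: "\<bar>f x - F x\<bar> ^ 2 = (f x - (c + (\<Sum>i<M * L. a i * relu (v i \<bullet> x + b i))))\<^sup>2" if "x \<in> space \<mu>" for x
    using F(2) that space by simp
  have "integrable \<mu> (\<lambda>x. \<bar>f x - F x\<bar> ^ 2)"
    using int by (subst Bochner_Integration.integrable_cong[OF refl eq])
  moreover have "(LINT x|\<mu>. \<bar>f x - F x\<bar> ^ 2) \<le> 8 * (fourier_const fhat B)\<^sup>2 / (real M * real L)"
    using le by (subst Bochner_Integration.integral_cong[OF refl eq]) simp_all
  ultimately show ?thesis
    using F(1) by blast
qed

end
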